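(* Let $n\ge1$, let $\mathcal{C}\subset\mathbb{H}^n$ be a convex set and let $f:\mathcal{C}\to\mathbb{R}$ be second-order continuously real-differentiable. Then $f$ is convex if and only if $$\boldsymbol{H}_{\mathcal{H}\mathcal{H}^*}\succeq\boldsymbol{O}$$ at every point $\boldsymbol{q}\in\mathcal{C}$, where $\boldsymbol{H}_{\mathcal{H}\mathcal{H}^*}\in\mathbb{H}^{4n\times4n}$ is the augmented quaternion Hessian matrix of $f$.
   Context: $\mathbb{H}$ is the algebra of real quaternions $q=q_a+q_bi+q_cj+q_dk$ ($i^2=j^2=k^2=ijk=-1$), $\mathrm{Re}\{q\}=q_a$, $q^*=q_a-q_bi-q_cj-q_dk$; $(\cdot)^{\mathsf{H}}$ is the conjugate transpose. For nonzero $\mu\in\mathbb{H}$, $q^\mu=\mu q\mu^{-1}$, and $q^{\mu*}=(q^\mu)^*$. A set $\mathcal{C}\subset\mathbb{H}^n$ is convex if it is closed under $\theta\boldsymbol{x}+(1-\theta)\boldsymbol{y}$, $0\le\theta\le1$ real; $f:\mathcal{C}\to\mathbb{R}$ is convex if $\mathcal{C}$ is convex and $f(\theta\boldsymbol{x}+(1-\theta)\boldsymbol{y})\le\theta f(\boldsymbol{x})+(1-\theta)f(\boldsymbol{y})$ for all $\boldsymbol{x},\boldsymbol{y}\in\mathcal{C}$, $0\le\theta\le1$. Second-order continuously real-differentiable means that $f$, as a function of the $4n$ real components of $\boldsymbol{q}$, is twice continuously differentiable at every point of $\mathcal{C}$ ($f$ is defined only on $\mathcal{C}$, so partial derivatives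 at points of $\mathcal{C}$ are the usual two-sided ones computed from values on $\mathcal{C}$). GHR derivatives: for a real-differentiable $\mathbb{H}$-valued (in particular real-valued) function $g$ of $\boldsymbol{q}=(q_1,\dots,q_n)^{\mathsf{T}}$ with $q_l=q_{l,a}+q_{l,b}i+q_{l,c}j+q_{l,d}k$, and nonzero $\mu\in\mathbb{H}$, $$\frac{\partial g}{\partial q_l^{\mu}}=\frac14\left(\frac{\partial g}{\partial q_{l,a}}-\frac{\partial g}{\partial q_{l,b}}i^\mu-\frac{\partial g}{\partial q_{l,c}}j^\mu-\frac{\partial g}{\partial q_{l,d}}k^\mu\right),\quad \frac{\partial g}{\partial q_l^{\mu*}}=\frac14\left(\frac{\partial g}{\partial q_{l,a}}+\frac{\partial g}{\partial q_{l,b}}i^\mu+\frac{\partial g}{\partial q_{l,c}}j^\mu+\frac{\partial g}{\partial q_{l,d}}k^\mu\right),$$ where the partial derivatives (in $\mathbb{H}$) multiply from the left. For $\mu,\nu\in\{1,i,j,k\}$, $\boldsymbol{H}_{\boldsymbol{q}^\nu\boldsymbol{q}^{\mu*}}=\frac{\partial}{\partial\boldsymbol{q}^\nu}\left(\frac{\partial f}{\partial\boldsymbol{q}^{\mu*}}\right)^{\mathsf{T}}\in\mathbb{H}^{n\times n}$ is the matrix whose $(m,l)$ entry is $\frac{\partial}{\partial q_l^\nu}\left(\frac{\partial f}{\partial q_m^{\mu*}}\right)$. The augmented quaternion Hessian $\boldsymbol{H}_{\mathcal{H}\mathcal{H}^*}\in\mathbb{H}^{4n\times4n}$ is the $4\times4$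 block matrix whose block in row $\mu$ and column $\nu$ (rows and columns ordered $1,i,j,k$) is $\boldsymbol{H}_{\boldsymbol{q}^\nu\boldsymbol{q}^{\mu*}}$. A matrix $\boldsymbol{A}\in\mathbb{H}^{N\times N}$ is positive semi-definite, written $\boldsymbol{A}\succeq\boldsymbol{O}$, if $\mathrm{Re}\{\boldsymbol{x}^{\mathsf{H}}\boldsymbol{A}\boldsymbol{x}\}\ge0$ for all nonzero $\boldsymbol{x}\in\mathbb{H}^N$. *)

theory Defs
  imports "HOL-Analysis.Analysis"
begin

section \<open>Real quaternions\<close>

datatype quat = Quat (qa: real) (qb: real) (qc: real) (qd: real)

lemma quat_eq_iff: "p = q \<longleftrightarrow> qa p = qa q \<and> qb p = qb q \<and> qc p = qc q \<and> qd p = qd q"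
  by (cases p; cases q) simp

instantiation quat :: division_ring
begin

definition "0 = Quat 0 0 0 0"
definition "1 = Quat 1 0 0 0"
definition "p + q = Quat (qa p + qa q) (qb p + qb q) (qc p + qc q) (qd p + qd q)"
definition "p - q = Quat (qa p - qa q) (qb p - qb q) (qc p - qc q) (qd p - qd q)"
definition "- q = Quat (- qa q) (- qb q) (- qc q) (- qd q)"
definition "p * q = Quat
  (qa p * qa q - qb p * qb q - qc p * qc q - qd p * qd q)
  (qa p * qb q + qb p * qa q + qc p * qd q - qd p * qc q)
  (qa p * qc q - qb p * qd q + qc p * qa q + qd p * qb q)
  (qa p * qd q + qb p * qc q - qc p * qb q + qd p * qa q)"
definition "inverse q = (let N = (qa q)\<^sup>2 + (qb q)\<^sup>2 + (qc q)\<^sup>2 + (qd q)\<^sup>2 in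
  Quat (qa q / N) (- qb q / N) (- qc q / N) (- qd q / N))"
definition "p div q = p * inverse (q :: quat)"

lemmas quat_ring_defs = zero_quat_def one_quat_def plus_quat_def minus_quat_def
  uminus_quat_def times_quat_def

lemma quat_norm2_pos:
  assumes "q \<noteq> 0"
  shows "(qa q)\<^sup>2 + (qb q)\<^sup>2 + (qc q)\<^sup>2 + (qd q)\<^sup>2 > 0"
proof (rule ccontr)
  assume "\<not> ?thesis"
  moreover have "(qa q)\<^sup>2 \<ge> 0" "(qb q)\<^sup>2 \<ge> 0" "(qc q)\<^sup>2 \<ge> 0" "(qd q)\<^sup>2 \<ge> 0"
    by simp_all
  ultimately have "(qa q)\<^sup>2 = 0" "(qb q)\<^sup>2 = 0" "(qc q)\<^sup>2 = 0" "(qd q)\<^sup>2 = 0"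
    by linarith+
  with assms show False by (simp add: quat_eq_iff zero_quat_def)
qed

instance
proof
  fix p q r :: quat
  show "p + q + r = p + (q + r)" "p + q = q + p" "0 + p = p" "- p + p = 0" "p - q = p + - q"
    "p * q * r = p * (q * r)" "1 * p = p" "p * 1 = p" "(p + q) * r = p * r + q * r"
    "p * (q + r) = p * q + p * r" "(0 :: quat) \<noteq> 1"
    by (simp_all add: quat_ring_defs quat_eq_iff algebra_simps)
  show "p div q = p * inverse q" by (rule divide_quat_def)
  show "inverse (0 :: quat) = 0" by (simp add: inverse_quat_def zero_quat_def)
  assume "p \<noteq> 0"
  define N where "N = (qa p)\<^sup>2 + (qb p)\<^sup>2 + (qc p)\<^sup>2 + (qd p)\<^sup>2"
  have N: "N \<noteq> 0" using quat_norm2_pos[OF \<open>p \<noteq> 0\<close>] by (simp add: N_def)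
  have *: "qa p * qa p / N + qb p * qb p / N + qc p * qc p / N + qd p * qd p / N = 1"
    using N by (simp add: add_divide_distrib[symmetric]) (simp add: N_def power2_eq_square)
  have inv: "inverse p = Quat (qa p / N) (- qb p / N) (- qc p / N) (- qd p / N)"
    by (simp add: inverse_quat_def N_def Let_def)
  show "inverse p * p = 1" "p * inverse p = 1"
    using * by (simp_all add: inv times_quat_def one_quat_def mult.commute)
qed

end

instantiation quat :: real_algebra_1
begin

definition "r *\<^sub>R q = Quat (r * qa q) (r * qb q) (r * qc q) (r * qd q)"

instance
proof
  fix a b :: real and p q :: quat
  show "a *\<^sub>R (p + q) = a *\<^sub>R p + a *\<^sub>R q" "(a + b) *\<^sub>R p = a *\<^sub>R p + b *\<^sub>R p"
    "a *\<^sub>R b *\<^sub>R p = (a * b) *\<^sub>R p" "1 *\<^sub>R p = p"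
    "a *\<^sub>R p * q = a *\<^sub>R (p * q)" "p * a *\<^sub>R q = a *\<^sub>R (p * q)"
    by (simp_all add: scaleR_quat_def plus_quat_def times_quat_def quat_eq_iff algebra_simps)
qed

end

instantiation quat :: real_inner
begin

definition "inner p q = qa p * qa q + qb p * qb q + qc p * qc q + qd p * qd q"
definition norm_quat_def: "norm (q :: quat) = sqrt (inner q q)"
definition "sgn (q :: quat) = q /\<^sub>R norm q"
definition "dist (p :: quat) q = norm (p - q)"
definition uniformity_quat_def:
  "(uniformity :: (quat \<times> quat) filter) = (INF e\<in>{0<..}. principal {(x, y). dist x y < e})"
definition open_quat_def:
  "open (U :: quat set) \<longleftrightarrow> (\<forall>x\<in>U. eventually (\<lambda>(x', y). x' = x \<longrightarrow> y \<in> U) uniformity)"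

instance
proof
  fix p q r :: quat and a :: real and U :: "quat set"
  show "dist p q = norm (p - q)" by (rule dist_quat_def)
  show "sgn p = p /\<^sub>R norm p" by (rule sgn_quat_def)
  show "(uniformity :: (quat \<times> quat) filter) = (INF e\<in>{0<..}. principal {(x, y). dist x y < e})"
    by (rule uniformity_quat_def)
  show "open U \<longleftrightarrow> (\<forall>x\<in>U. eventually (\<lambda>(x', y). x' = x \<longrightarrow> y \<in> U) uniformity)"
    by (rule open_quat_def)
  show "inner p q = inner q p" by (simp add: inner_quat_def mult.commute)
  show "inner (p + q) r = inner p r + inner q r"
    by (simp add: inner_quat_def plus_quat_def algebra_simps)
  show "inner (a *\<^sub>R p) q = a * inner p q"
    by (simp add: inner_quat_def scaleR_quat_def algebra_simps)
  show "0 \<le> inner p p" by (simp add: inner_quat_def)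
  show "inner p p = 0 \<longleftrightarrow> p = 0"
  proof
    show "inner p p = 0 \<Longrightarrow> p = 0"
      using quat_norm2_pos[of p] by (cases "p = 0") (simp_all add: inner_quat_def power2_eq_square)
  qed (simp add: inner_quat_def zero_quat_def)
  show "norm p = sqrt (inner p p)" by (rule norm_quat_def)
qed

end

definition quat_i :: quat where "quat_i = Quat 0 1 0 0"
definition quat_j :: quat where "quat_j = Quat 0 0 1 0"
definition quat_k :: quat where "quat_k = Quat 0 0 0 1"

lemma quat_unit_mult:
  "quat_i * quat_i = -1" "quat_j * quat_j = -1" "quat_k * quat_k = -1"
  "quat_i * quat_j * quat_k = -1"
  by (simp_all add: quat_i_def quat_j_def quat_k_def quat_ring_defs)

instantiation quat :: euclidean_space
begin

definition "Basis = {1, quat_i, quat_j, quat_k}"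

instance
proof
  fix u v x :: quat
  show "(Basis :: quat set) \<noteq> {}" "finite (Basis :: quat set)"
    by (simp_all add: Basis_quat_def)
  show "(\<forall>u\<in>Basis. inner x u = 0) \<longleftrightarrow> x = 0"
    by (cases x) (simp add: Basis_quat_def inner_quat_def quat_i_def quat_j_def quat_k_def
        one_quat_def zero_quat_def)
  assume "u \<in> Basis" "v \<in> Basis"
  then show "inner u v = (if u = v then 1 else 0)"
    unfolding Basis_quat_def insert_iff empty_iff
    by (elim disjE) (simp_all add: inner_quat_def quat_i_def quat_j_def quat_k_def one_quat_def)
qed

end

definition quat_cnj :: "quat \<Rightarrow> quat"
  where "quat_cnj q = Quat (qa q) (- qb q) (- qc q) (- qd q)"

text \<open>The rotation $q^\mu = \mu q \mu^{-1}$.\<close>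

definition quat_rot :: "quat \<Rightarrow> quat \<Rightarrow> quat"
  where "quat_rot q \<mu> = \<mu> * q * inverse \<mu>"

text \<open>
  The units $1, i, j, k$ index both the real components of a quaternion and the block rows and
  columns of the augmented Hessian.
\<close>

datatype qunit = U1 | Ui | Uj | Uk

lemma UNIV_qunit: "UNIV = {U1, Ui, Uj, Uk}"
  by (auto intro: qunit.exhaust)

instance qunit :: finite
  by standard (simp add: UNIV_qunit)

primrec qunit_val :: "qunit \<Rightarrow> quat" where
  "qunit_val U1 = 1"
| "qunit_val Ui = quat_i"
| "qunit_val Uj = quat_j"
| "qunit_val Uk = quat_k"

section \<open>Partial derivatives and GHR derivatives\<close>

text \<open>
  The line through \<open>q\<close> along which only the real component \<open>u\<close> of the coordinate \<open>q $ l\<close> varies.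
\<close>

definition coord_line :: "'n::finite \<Rightarrow> qunit \<Rightarrow> quat ^ 'n \<Rightarrow> real \<Rightarrow> quat ^ 'n"
  where "coord_line l u q t = q + t *\<^sub>R axis l (qunit_val u)"

definition partial ::
    "'n::finite \<Rightarrow> qunit \<Rightarrow> (quat ^ 'n \<Rightarrow> 'a::real_normed_vector) \<Rightarrow> quat ^ 'n \<Rightarrow> 'a"
  where "partial l u g q = vector_derivative (\<lambda>t. g (coord_line l u q t)) (at 0)"

text \<open>
  A function on \<open>C\<close> is a total function whose values off \<open>C\<close> are irrelevant. A two-sided partial
  derivative at \<open>q\<close> therefore exists only if the coordinate line through \<open>q\<close> stays in \<open>C\<close> near \<open>q\<close>
  (so a convex set \<open>C\<close> on which all the partial derivatives exist is open).
\<close>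

definition has_partial_on ::
    "(quat ^ 'n::finite) set \<Rightarrow> 'n \<Rightarrow> qunit \<Rightarrow> (quat ^ 'n \<Rightarrow> 'a::real_normed_vector) \<Rightarrow> bool"
  where "has_partial_on C l u g \<longleftrightarrow>
    (\<forall>q\<in>C. (\<forall>\<^sub>F t in at 0. coord_line l u q t \<in> C) \<and>
      (\<lambda>t. g (coord_line l u q t)) differentiable (at 0))"

definition twice_cont_real_differentiable_on ::
    "(quat ^ 'n::finite) set \<Rightarrow> (quat ^ 'n \<Rightarrow> 'a::real_normed_vector) \<Rightarrow> bool"
  where "twice_cont_real_differentiable_on C g \<longleftrightarrow>
    (\<forall>l u. has_partial_on C l u g \<and> continuous_on C (partial l u g) \<and>
      (\<forall>m v. has_partial_on C m v (partial l u g) \<and>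
        continuous_on C (partial m v (partial l u g))))"

text \<open>$\partial g / \partial q_l^\mu$ and $\partial g / \partial q_l^{\mu*}$\<close>

definition ghr_deriv :: "quat \<Rightarrow> 'n::finite \<Rightarrow> (quat ^ 'n \<Rightarrow> quat) \<Rightarrow> quat ^ 'n \<Rightarrow> quat"
  where "ghr_deriv \<mu> l g q = (1/4) *\<^sub>R
    (partial l U1 g q - partial l Ui g q * quat_rot quat_i \<mu>
      - partial l Uj g q * quat_rot quat_j \<mu> - partial l Uk g q * quat_rot quat_k \<mu>)"

definition ghr_conj_deriv :: "quat \<Rightarrow> 'n::finite \<Rightarrow> (quat ^ 'n \<Rightarrow> quat) \<Rightarrow> quat ^ 'n \<Rightarrow> quat"
  where "ghr_conj_deriv \<mu> l g q = (1/4) *\<^sub>R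
    (partial l U1 g q + partial l Ui g q * quat_rot quat_i \<mu>
      + partial l Uj g q * quat_rot quat_j \<mu> + partial l Uk g q * quat_rot quat_k \<mu>)"

section \<open>Augmented Hessian and positive semi-definiteness\<close>

text \<open>The matrix $H_{q^\nu q^{\mu*}}$\<close>

definition ghr_hessian ::
    "quat \<Rightarrow> quat \<Rightarrow> (quat ^ 'n::finite \<Rightarrow> real) \<Rightarrow> quat ^ 'n \<Rightarrow> quat ^ 'n ^ 'n"
  where "ghr_hessian \<nu> \<mu> f q =
    (\<chi> m l. ghr_deriv \<nu> l (ghr_conj_deriv \<mu> m (\<lambda>p. of_real (f p))) q)"

text \<open>
  The index type \<^typ>\<open>qunit \<times> 'n\<close>, with $4n$ elements, carries the block structure: the block in
  row \<open>\<mu>\<close> and column \<open>\<nu>\<close> is $H_{q^\nu q^{\mu*}}$.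
\<close>

definition augmented_hessian ::
    "(quat ^ 'n::finite \<Rightarrow> real) \<Rightarrow> quat ^ 'n \<Rightarrow> quat ^ (qunit \<times> 'n) ^ (qunit \<times> 'n)"
  where "augmented_hessian f q =
    (\<chi> r c. ghr_hessian (qunit_val (fst c)) (qunit_val (fst r)) f q $ snd r $ snd c)"

definition quat_psd :: "quat ^ 'm::finite ^ 'm \<Rightarrow> bool"
  where "quat_psd A \<longleftrightarrow>
    (\<forall>x. x \<noteq> 0 \<longrightarrow> qa (\<Sum>r\<in>UNIV. quat_cnj (x $ r) * (A *v x) $ r) \<ge> 0)"

end

theory Submission
  imports Defs
begin

text \<open>
  Both sides of the equivalence say that the quadratic form of the ordinary real Hessian of \<open>f\<close>, in
  the \<open>4n\<close> real components, is nonnegative at every point of \<open>C\<close>.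

  For convexity this is the classical second-order criterion, proved by restricting \<open>f\<close> to lines
  (\<open>convex_on_iff_second_derivatives_nonneg\<close>). The hypothesis only speaks of partial derivatives
  along coordinate axes; that continuous partial derivatives determine the derivative in every
  direction is \<open>has_derivative_from_continuous_partials\<close>. Applied to \<open>f\<close> and then to its first
  partial derivatives, it identifies the second derivative of \<open>f\<close> along a line with the Hessian form.

  For positive semi-definiteness, let \<open>J\<close> be the \<open>4n \<times> 4n\<close> quaternion matrix whose entry at row
  \<open>(\<mu>, m)\<close> and column \<open>(u, m)\<close> is the rotated unit $u^\mu$, and whose other entries vanish. It maps
  the real components of a vector to the augmented vector, and the definition of the GHR derivatives
  says that the augmented Hessian is $\frac{1}{16} J H J^{\mathsf H}$ with \<open>H\<close> the real Hessian
  (\<open>augmented_hessian_entry\<close>). As \<open>H\<close> is real, the real part of $x^{\mathsf H} J H J^{\mathsf H} x$ is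
  the sum of the values of the real Hessian form at the four real component vectors of
  $J^{\mathsf H} x$ (\<open>qa_augmented_hessian_form\<close>); so it is nonnegative if the form is. Conversely
  $J^{\mathsf H} J = 4I$, so that $J^{\mathsf H} x$ runs through all real vectors
  (\<open>real_coords_surj\<close>), and positive semi-definiteness gives back the nonnegativity of the form.
\<close>

section \<open>Directional derivatives from continuous partial derivatives\<close>

lemma eventually_scaled_nhds_0:
  assumes "\<forall>\<^sub>F t in nhds (0::real). P t"
  shows "\<forall>\<^sub>F t in nhds 0. P (c * t)"
proof -
  have "((\<lambda>t. c * t) \<longlongrightarrow> c * 0) (nhds 0)"
    by (intro tendsto_intros filterlim_ident)
  then show ?thesis
    using eventually_compose_filterlim[OF assms, of "\<lambda>t. c * t" "nhds 0"] by simp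
qed

text \<open>
  A convex set that contains a short piece of each axis through \<open>p\<close> contains a short piece of every
  line through \<open>p\<close>: a point in direction \<open>v + d\<^sub>i e\<^sub>i\<close> is the midpoint of points, twice as far away,
  in directions \<open>v\<close> and \<open>d\<^sub>i e\<^sub>i\<close>. This replaces openness of the set in all that follows.
\<close>

lemma eventually_convex_combination_line:
  fixes e :: "'i \<Rightarrow> 'a::real_normed_vector" and d :: "'i \<Rightarrow> real"
  assumes "finite F" "convex C" "p \<in> C"
    and "\<And>i. i \<in> F \<Longrightarrow> \<forall>\<^sub>F t in nhds (0::real). p + t *\<^sub>R e i \<in> C"
  shows "\<forall>\<^sub>F t in nhds (0::real). p + t *\<^sub>R (\<Sum>i\<in>F. d i *\<^sub>R e i) \<in> C"
  using assms(1,4)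
proof (induction F rule: finite_induct)
  case empty
  then show ?case using \<open>p \<in> C\<close> by simp
next
  case (insert i F)
  let ?v = "\<Sum>i\<in>F. d i *\<^sub>R e i"
  have "\<forall>\<^sub>F t in nhds (0::real). p + (2 * t) *\<^sub>R ?v \<in> C"
    using insert by (intro eventually_scaled_nhds_0) blast
  moreover have "\<forall>\<^sub>F t in nhds (0::real). p + (2 * d i * t) *\<^sub>R e i \<in> C"
    using insert by (intro eventually_scaled_nhds_0) blast
  ultimately show ?case
  proof eventually_elim
    case (elim t)
    have "(1/2) *\<^sub>R (p + (2 * t) *\<^sub>R ?v) + (1/2) *\<^sub>R (p + (2 * d i * t) *\<^sub>R e i) \<in> C"
      using elim \<open>convex C\<close> by (intro convexD) auto
    moreover have "(1/2) *\<^sub>R p + ((1/2) *\<^sub>R p + x) = p + x" for x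
      by (simp flip: add.assoc scaleR_left_distrib)
    ultimately show ?case
      using insert.hyps by (simp add: algebra_simps)
  qed
qed

text \<open>
  Partial derivatives are taken at parameter \<open>0\<close> of the line through the point in question; shifting
  the parameter turns them into derivatives of one function along a fixed line.
\<close>

lemma has_real_derivative_along_line:
  fixes f :: "'a::real_normed_vector \<Rightarrow> real"
  assumes "\<And>t. p + t *\<^sub>R e \<in> C \<Longrightarrow>
    ((\<lambda>s. f ((p + t *\<^sub>R e) + s *\<^sub>R e)) has_real_derivative D (p + t *\<^sub>R e)) (at 0)"
    and "p + t *\<^sub>R e \<in> C"
  shows "((\<lambda>t. f (p + t *\<^sub>R e)) has_real_derivative D (p + t *\<^sub>R e)) (at t)"
proof -
  have "(\<lambda>s. f (p + (s + t) *\<^sub>R e)) = (\<lambda>s. f ((p + t *\<^sub>R e) + s *\<^sub>R e))"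
    by (simp add: algebra_simps)
  then show ?thesis
    using DERIV_shift[of "\<lambda>t. f (p + t *\<^sub>R e)" _ 0 t] assms by simp
qed

text \<open>
  The mean value inequality for \<open>t \<mapsto> f (a + t e) - t L\<close>, on a convex set where the
  derivative of \<open>f\<close> in direction \<open>e\<close> is within \<open>\<epsilon>\<close> of \<open>L\<close>.
\<close>

lemma line_increment_bound:
  fixes f :: "'a::real_normed_vector \<Rightarrow> real"
  assumes "convex K" "a \<in> K" "a + s *\<^sub>R e \<in> K"
    and der: "\<And>q. q \<in> K \<Longrightarrow> ((\<lambda>t. f (q + t *\<^sub>R e)) has_real_derivative D q) (at 0)"
    and bound: "\<And>q. q \<in> K \<Longrightarrow> \<bar>D q - L\<bar> \<le> \<epsilon>"
  shows "\<bar>f (a + s *\<^sub>R e) - f a - s * L\<bar> \<le> \<epsilon> * \<bar>s\<bar>"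
proof -
  let ?h = "\<lambda>t. f (a + t *\<^sub>R e) - t * L"
  have inK: "a + t *\<^sub>R e \<in> K" if t: "t \<in> closed_segment 0 s" for t
  proof -
    obtain u where u: "0 \<le> u" "u \<le> 1" "t = u * s"
      using t by (auto simp: in_segment)
    have "(1 - u) *\<^sub>R a + u *\<^sub>R (a + s *\<^sub>R e) \<in> K"
      using u assms by (intro convexD) auto
    then show ?thesis using u by (simp add: algebra_simps)
  qed
  have "norm (?h s - ?h 0) \<le> \<epsilon> * norm (s - 0)"
  proof (rule field_differentiable_bound[where S="closed_segment 0 s"])
    fix t assume t: "t \<in> closed_segment 0 s"
    have "((\<lambda>t. f (a + t *\<^sub>R e)) has_real_derivative D (a + t *\<^sub>R e)) (at t)"
      using has_real_derivative_along_line[where C=K and D=D and f=f] der inK[OF t] by blast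
    then have "(?h has_real_derivative D (a + t *\<^sub>R e) - L) (at t)"
      by (auto intro!: derivative_eq_intros)
    then show "(?h has_real_derivative D (a + t *\<^sub>R e) - L) (at t within closed_segment 0 s)"
      by (rule has_field_derivative_at_within)
    show "norm (D (a + t *\<^sub>R e) - L) \<le> \<epsilon>"
      using bound[OF inK[OF t]] by simp
  qed auto
  then show ?thesis by (simp add: algebra_simps)
qed

text \<open>
  Induction on the set of directions: adding a direction \<open>e\<^sub>i\<close> adds to the difference quotient the
  increment of \<open>f\<close> from \<open>p + t v\<close> to \<open>p + t v + t d\<^sub>i e\<^sub>i\<close>, divided by \<open>t\<close>. That segment is parallel
  to \<open>e\<^sub>i\<close> and shrinks to \<open>p\<close> within \<open>C\<close>, so by continuity of the partial derivative the quotient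
  tends to \<open>d\<^sub>i D\<^sub>i p\<close>.
\<close>

lemma has_derivative_from_continuous_partials:
  fixes f :: "'a::real_normed_vector \<Rightarrow> real" and e :: "'i \<Rightarrow> 'a" and d :: "'i \<Rightarrow> real"
  assumes "finite F" and C: "convex C" and p: "p \<in> C"
    and "\<And>i. i \<in> F \<Longrightarrow> \<forall>\<^sub>F t in nhds (0::real). p + t *\<^sub>R e i \<in> C"
    and "\<And>i q. i \<in> F \<Longrightarrow> q \<in> C \<Longrightarrow> ((\<lambda>t. f (q + t *\<^sub>R e i)) has_real_derivative D i q) (at 0)"
    and "\<And>i. i \<in> F \<Longrightarrow> continuous_on C (D i)"
  shows "((\<lambda>t. f (p + t *\<^sub>R (\<Sum>i\<in>F. d i *\<^sub>R e i))) has_real_derivative (\<Sum>i\<in>F. d i * D i p)) (at 0)"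
  using assms(1,4-)
proof (induction F rule: finite_induct)
  case empty
  then show ?case by simp
next
  case (insert i F)
  let ?v = "\<Sum>i\<in>F. d i *\<^sub>R e i"
  let ?w = "?v + d i *\<^sub>R e i"
  have IH: "((\<lambda>t. f (p + t *\<^sub>R ?v)) has_real_derivative (\<Sum>i\<in>F. d i * D i p)) (at 0)"
    using insert by blast
  have inC: "\<forall>\<^sub>F t in nhds (0::real). p + t *\<^sub>R (\<Sum>i\<in>G. d i *\<^sub>R e i) \<in> C" if "G \<subseteq> insert i F" for G
    using that insert.prems(1) insert.hyps
    by (intro eventually_convex_combination_line C p) (auto intro: finite_subset)
  have "((\<lambda>t. (f (p + t *\<^sub>R ?w) - f (p + t *\<^sub>R ?v)) / t) \<longlongrightarrow> d i * D i p) (at 0)"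
  proof (rule tendstoI)
    fix \<epsilon> :: real assume "\<epsilon> > 0"
    \<comment> \<open>The \<open>+ 1\<close> covers the case \<open>d i = 0\<close>.\<close>
    define \<eta> where "\<eta> = \<epsilon> / (\<bar>d i\<bar> + 1)"
    have \<eta>: "\<eta> > 0" "\<eta> * \<bar>d i\<bar> < \<epsilon>"
      using \<open>\<epsilon> > 0\<close> by (auto simp: \<eta>_def field_simps add_pos_nonneg)
    obtain r where r: "r > 0" "\<And>q. q \<in> C \<Longrightarrow> dist q p < r \<Longrightarrow> dist (D i q) (D i p) < \<eta>"
      using insert.prems(3)[of i] p \<eta>(1) unfolding continuous_on_iff by blast
    have near: "\<forall>\<^sub>F t in at (0::real). p + t *\<^sub>R u \<in> ball p r" for u
    proof -
      have "((\<lambda>t. p + t *\<^sub>R u) \<longlongrightarrow> p + 0 *\<^sub>R u) (at (0::real))"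
        by (intro tendsto_intros)
      then show ?thesis
        using r(1) by (intro topological_tendstoD) auto
    qed
    have "\<forall>\<^sub>F t in at (0::real). p + t *\<^sub>R ?v \<in> C"
      using inC[of F] by (auto simp: eventually_nhds_conv_at)
    moreover have "\<forall>\<^sub>F t in at (0::real). p + t *\<^sub>R ?w \<in> C"
      using inC[of "insert i F"] insert.hyps by (auto simp: eventually_nhds_conv_at add.commute)
    moreover have "\<forall>\<^sub>F t in at (0::real). t \<noteq> 0"
      by (rule eventually_neq_at_within)
    ultimately show "\<forall>\<^sub>F t in at 0.
        dist ((f (p + t *\<^sub>R ?w) - f (p + t *\<^sub>R ?v)) / t) (d i * D i p) < \<epsilon>"
      using near[of ?v] near[of ?w]
    proof eventually_elim
      case (elim t)
      have w: "p + t *\<^sub>R ?w = (p + t *\<^sub>R ?v) + (t * d i) *\<^sub>R e i"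
        by (simp add: algebra_simps)
      have "\<bar>f ((p + t *\<^sub>R ?v) + (t * d i) *\<^sub>R e i) - f (p + t *\<^sub>R ?v) - t * d i * D i p\<bar>
          \<le> \<eta> * \<bar>t * d i\<bar>"
      proof (rule line_increment_bound[where K = "C \<inter> ball p r" and D = "D i"])
        show "convex (C \<inter> ball p r)" by (intro convex_Int C convex_ball)
        show "p + t *\<^sub>R ?v \<in> C \<inter> ball p r" using elim by blast
        show "(p + t *\<^sub>R ?v) + (t * d i) *\<^sub>R e i \<in> C \<inter> ball p r" using elim w by simp
        show "\<bar>D i q - D i p\<bar> \<le> \<eta>" if "q \<in> C \<inter> ball p r" for q
          using r(2)[of q] that by (simp add: dist_real_def dist_commute)
      qed (use insert.prems(2) in auto)
      then have "\<bar>f (p + t *\<^sub>R ?w) - f (p + t *\<^sub>R ?v) - t * (d i * D i p)\<bar> \<le> \<bar>t\<bar> * (\<eta> * \<bar>d i\<bar>)"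
        by (simp only: w abs_mult mult_ac)
      also have "\<dots> < \<bar>t\<bar> * \<epsilon>"
        using elim \<eta>(2) by simp
      finally have "\<bar>f (p + t *\<^sub>R ?w) - f (p + t *\<^sub>R ?v) - t * (d i * D i p)\<bar> / \<bar>t\<bar> < \<epsilon>"
        using elim by (simp add: field_simps)
      then show ?case
        using elim by (simp add: dist_real_def diff_divide_distrib flip: abs_divide)
    qed
  qed
  moreover have "((\<lambda>t. (f (p + t *\<^sub>R ?v) - f p) / t) \<longlongrightarrow> (\<Sum>i\<in>F. d i * D i p)) (at 0)"
    using IH by (simp add: DERIV_def)
  ultimately have "((\<lambda>t. (f (p + t *\<^sub>R ?w) - f (p + t *\<^sub>R ?v)) / t + (f (p + t *\<^sub>R ?v) - f p) / t)
      \<longlongrightarrow> d i * D i p + (\<Sum>i\<in>F. d i * D i p)) (at 0)"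
    by (rule tendsto_add)
  then have "((\<lambda>t. (f (p + t *\<^sub>R ?w) - f p) / t) \<longlongrightarrow> d i * D i p + (\<Sum>i\<in>F. d i * D i p)) (at 0)"
    by (simp flip: add_divide_distrib)
  then show ?case
    using insert.hyps by (simp add: DERIV_def add.commute)
qed

section \<open>Second-order criterion for convexity\<close>

text \<open>
  The graph lies above its tangents at \<open>0\<close> and at \<open>t\<close>; adding the two inequalities shows that the
  difference quotient of \<open>g'\<close> at \<open>0\<close> is nonnegative.
\<close>

lemma convex_on_imp_second_derivative_nonneg:
  fixes g :: "real \<Rightarrow> real"
  assumes "convex_on {-r<..<r} g" "r > 0"
    and g': "\<And>t. t \<in> {-r<..<r} \<Longrightarrow> (g has_real_derivative g' t) (at t)"
    and g'': "(g' has_real_derivative c) (at 0)"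
  shows "c \<ge> 0"
proof -
  have tangent: "g t - g s \<ge> g' s * (t - s)" if "s \<in> {-r<..<r}" "t \<in> {-r<..<r}" for s t
    using that assms
    by (intro convex_on_imp_above_tangent[where A="{-r<..<r}"])
      (auto simp: interior_open intro: has_field_derivative_at_within)
  have "((\<lambda>t. (g' t - g' 0) / t) \<longlongrightarrow> c) (at 0)"
    using g'' by (simp add: DERIV_def)
  moreover have "\<forall>\<^sub>F t in at 0. (g' t - g' 0) / t \<ge> 0"
  proof -
    have "\<forall>\<^sub>F t in at (0::real). t \<in> {-r<..<r}"
      using \<open>r > 0\<close> by (intro eventually_at_in_open') auto
    then show ?thesis
    proof eventually_elim
      case (elim t)
      have "(g' t - g' 0) * t \<ge> 0"
        using tangent[of 0 t] tangent[of t 0] elim \<open>r > 0\<close> by (simp add: algebra_simps)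
      then show ?case
        by (auto simp: zero_le_mult_iff zero_le_divide_iff)
    qed
  qed
  ultimately show ?thesis
    by (rule tendsto_lowerbound) simp
qed

text \<open>
  Convexity only concerns the restrictions of \<open>f\<close> to lines, so the one-dimensional criterion applies.
  Here \<open>G v\<close> and \<open>Q v\<close> are the first and second derivatives of \<open>f\<close> in direction \<open>v\<close>.
\<close>

lemma convex_on_iff_second_derivatives_nonneg:
  fixes f :: "'a::real_normed_vector \<Rightarrow> real"
  assumes C: "convex C"
    and inside: "\<And>p v. p \<in> C \<Longrightarrow> \<forall>\<^sub>F t in nhds (0::real). p + t *\<^sub>R v \<in> C"
    and G: "\<And>p v. p \<in> C \<Longrightarrow> ((\<lambda>t. f (p + t *\<^sub>R v)) has_real_derivative G v p) (at 0)"
    and Q: "\<And>p v. p \<in> C \<Longrightarrow> ((\<lambda>t. G v (p + t *\<^sub>R v)) has_real_derivative Q v p) (at 0)"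
  shows "convex_on C f \<longleftrightarrow> (\<forall>p\<in>C. \<forall>v. Q v p \<ge> 0)"
proof
  assume f: "convex_on C f"
  show "\<forall>p\<in>C. \<forall>v. Q v p \<ge> 0"
  proof (intro ballI allI)
    fix p v assume "p \<in> C"
    then obtain r where r: "r > 0" and rC: "\<And>t. t \<in> {-r<..<r} \<Longrightarrow> p + t *\<^sub>R v \<in> C"
      using inside[of p v] unfolding eventually_nhds_metric by (auto simp: dist_real_def abs_less_iff)
    show "Q v p \<ge> 0"
    proof (rule convex_on_imp_second_derivative_nonneg)
      show "convex_on {-r<..<r} (\<lambda>t. f (p + t *\<^sub>R v))"
      proof (rule convex_onI)
        fix u s t :: real assume u: "u > 0" "u < 1" and st: "s \<in> {-r<..<r}" "t \<in> {-r<..<r}"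
        have "f ((1 - u) *\<^sub>R (p + s *\<^sub>R v) + u *\<^sub>R (p + t *\<^sub>R v))
            \<le> (1 - u) * f (p + s *\<^sub>R v) + u * f (p + t *\<^sub>R v)"
          using u st rC by (intro convex_onD[OF f]) auto
        then show "f (p + ((1 - u) *\<^sub>R s + u *\<^sub>R t) *\<^sub>R v)
            \<le> (1 - u) * f (p + s *\<^sub>R v) + u * f (p + t *\<^sub>R v)"
          by (simp add: algebra_simps)
      qed auto
      show "((\<lambda>t. f (p + t *\<^sub>R v)) has_real_derivative G v (p + t *\<^sub>R v)) (at t)"
        if "t \<in> {-r<..<r}" for t
        using has_real_derivative_along_line[where C=C and D="G v" and f=f] G rC[OF that] by blast
    qed (use r Q[OF \<open>p \<in> C\<close>] in auto)
  qed
next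
  assume pos: "\<forall>p\<in>C. \<forall>v. Q v p \<ge> 0"
  show "convex_on C f"
  proof (rule convex_onI)
    fix u :: real and x y assume u: "0 < u" "u < 1" and xy: "x \<in> C" "y \<in> C"
    define v where "v = y - x"
    have inC: "x + t *\<^sub>R v \<in> C" if "t \<in> {0..1}" for t
    proof -
      have "(1 - t) *\<^sub>R x + t *\<^sub>R y \<in> C"
        using that xy C by (intro convexD) auto
      then show ?thesis by (simp add: v_def algebra_simps)
    qed
    have "convex_on {0..1} (\<lambda>t. f (x + t *\<^sub>R v))"
    proof (rule f''_ge0_imp_convex)
      fix t :: real assume t: "t \<in> {0..1}"
      show "((\<lambda>t. f (x + t *\<^sub>R v)) has_real_derivative G v (x + t *\<^sub>R v)) (at t)"
        using has_real_derivative_along_line[where C=C and D="G v" and f=f] G inC[OF t] by blast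
      show "((\<lambda>t. G v (x + t *\<^sub>R v)) has_real_derivative Q v (x + t *\<^sub>R v)) (at t)"
        using has_real_derivative_along_line[where C=C and D="Q v" and f="G v"] Q inC[OF t] by blast
      show "Q v (x + t *\<^sub>R v) \<ge> 0"
        using pos inC[OF t] by blast
    qed simp
    from convex_onD[OF this, of u 0 1] u
    show "f ((1 - u) *\<^sub>R x + u *\<^sub>R y) \<le> (1 - u) * f x + u * f y"
      by (simp add: v_def algebra_simps)
  qed (rule C)
qed

section \<open>The real Hessian\<close>

text \<open>The row index is the one of the inner derivative, as for the GHR Hessian.\<close>

definition real_hessian ::
    "(quat ^ 'n::finite \<Rightarrow> real) \<Rightarrow> quat ^ 'n \<Rightarrow> qunit \<times> 'n \<Rightarrow> qunit \<times> 'n \<Rightarrow> real"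
  where "real_hessian f q r c = partial (snd c) (fst c) (partial (snd r) (fst r) f) q"

definition hessian_form ::
    "(quat ^ 'n::finite \<Rightarrow> real) \<Rightarrow> quat ^ 'n \<Rightarrow> (qunit \<times> 'n \<Rightarrow> real) \<Rightarrow> real"
  where "hessian_form f q d = (\<Sum>r\<in>UNIV. \<Sum>c\<in>UNIV. d r * d c * real_hessian f q r c)"

definition real_axis :: "qunit \<times> 'n::finite \<Rightarrow> quat ^ 'n"
  where "real_axis r = axis (snd r) (qunit_val (fst r))"

lemma sum_UNIV_qunit: "(\<Sum>u\<in>UNIV. g u) = g U1 + g Ui + g Uj + g Uk"
  for g :: "qunit \<Rightarrow> 'a::comm_monoid_add"
  by (simp add: UNIV_qunit add.assoc)

lemma sum_UNIV_prod:
  "(\<Sum>r\<in>UNIV. g r) = (\<Sum>a\<in>UNIV. \<Sum>b\<in>UNIV. g (a, b))"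
  for g :: "'a::finite \<times> 'b::finite \<Rightarrow> 'c::comm_monoid_add"
  by (simp add: sum.cartesian_product)

lemmas qunit_defs = quat_i_def quat_j_def quat_k_def one_quat_def

lemma quat_components [simp]:
  "qa (p + q) = qa p + qa q" "qb (p + q) = qb p + qb q"
  "qc (p + q) = qc p + qc q" "qd (p + q) = qd p + qd q"
  "qa (t *\<^sub>R p) = t * qa p" "qb (t *\<^sub>R p) = t * qb p"
  "qc (t *\<^sub>R p) = t * qc p" "qd (t *\<^sub>R p) = t * qd p"
  "qa 0 = 0" "qb 0 = 0" "qc 0 = 0" "qd 0 = 0"
  by (simp_all add: plus_quat_def scaleR_quat_def zero_quat_def)

lemma qa_sum: "qa (\<Sum>i\<in>I. g i) = (\<Sum>i\<in>I. qa (g i))"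
  by (induction I rule: infinite_finite_induct) auto

lemma has_partial_onD:
  assumes "has_partial_on C l u g" "p \<in> C"
  shows "\<forall>\<^sub>F t in nhds (0::real). p + t *\<^sub>R real_axis (u, l) \<in> C"
    and "((\<lambda>t. g (p + t *\<^sub>R real_axis (u, l))) has_vector_derivative partial l u g p) (at 0)"
  using assms
  by (auto simp: has_partial_on_def coord_line_def real_axis_def eventually_nhds_conv_at partial_def
      vector_derivative_works)

lemma real_axis_expansion:
  "v = (\<Sum>r\<in>UNIV. inner (v $ snd r) (qunit_val (fst r)) *\<^sub>R real_axis r)"
proof (unfold vec_eq_iff, rule allI)
  fix l
  have "(\<Sum>r\<in>UNIV. inner (v $ snd r) (qunit_val (fst r)) *\<^sub>R real_axis r) $ l
     = (\<Sum>u\<in>UNIV. \<Sum>m\<in>UNIV. if m = l then inner (v $ m) (qunit_val u) *\<^sub>R qunit_val u else 0)"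
    unfolding sum_component sum_UNIV_prod
    by (intro sum.cong refl) (simp add: real_axis_def axis_def)
  also have "\<dots> = (\<Sum>u\<in>UNIV. inner (v $ l) (qunit_val u) *\<^sub>R qunit_val u)"
    by simp
  also have "\<dots> = v $ l"
    by (simp add: sum_UNIV_qunit quat_eq_iff inner_quat_def qunit_defs)
  finally show "v $ l = (\<Sum>r\<in>UNIV. inner (v $ snd r) (qunit_val (fst r)) *\<^sub>R real_axis r) $ l"
    by simp
qed

lemma real_coordinates_surj:
  fixes d :: "qunit \<times> 'n::finite \<Rightarrow> real"
  obtains v :: "quat ^ 'n" where "\<And>r. inner (v $ snd r) (qunit_val (fst r)) = d r"
proof
  fix r :: "qunit \<times> 'n"
  show "inner ((\<chi> l. \<Sum>u\<in>UNIV. d (u, l) *\<^sub>R qunit_val u) $ snd r) (qunit_val (fst r)) = d r"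
    by (cases r; cases "fst r") (simp_all add: sum_UNIV_qunit inner_quat_def qunit_defs)
qed

lemma convex_on_iff_hessian_form_nonneg:
  fixes C :: "(quat ^ 'n::finite) set" and f :: "quat ^ 'n \<Rightarrow> real"
  assumes C: "convex C" and f: "twice_cont_real_differentiable_on C f"
  shows "convex_on C f \<longleftrightarrow> (\<forall>p\<in>C. \<forall>d. hessian_form f p d \<ge> 0)"
proof -
  define coord :: "quat ^ 'n \<Rightarrow> qunit \<times> 'n \<Rightarrow> real"
    where "coord v r = inner (v $ snd r) (qunit_val (fst r))" for v r
  define D where "D r = partial (snd r) (fst r) f" for r
  have line: "p + t *\<^sub>R v = p + t *\<^sub>R (\<Sum>r\<in>UNIV. coord v r *\<^sub>R real_axis r)" for p v t
    using real_axis_expansion[of v] by (simp add: coord_def)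
  have D1: "((\<lambda>t. f (p + t *\<^sub>R real_axis r)) has_real_derivative D r p) (at 0)"
    and inside: "\<forall>\<^sub>F t in nhds (0::real). p + t *\<^sub>R real_axis r \<in> C"
    and D2: "((\<lambda>t. D r (p + t *\<^sub>R real_axis c)) has_real_derivative real_hessian f p r c) (at 0)"
    if "p \<in> C" for p r c
    using f that has_partial_onD[of C "snd r" "fst r" f p]
      has_partial_onD(2)[of C "snd c" "fst c" "D r" p]
    by (simp_all add: twice_cont_real_differentiable_on_def D_def real_hessian_def
        has_real_derivative_iff_has_vector_derivative)
  have cont: "continuous_on C (D r)" "continuous_on C (\<lambda>p. real_hessian f p r c)" for r c
    using f by (simp_all add: twice_cont_real_differentiable_on_def D_def real_hessian_def eta_contract_eq)
  have "convex_on C f \<longleftrightarrow> (\<forall>p\<in>C. \<forall>v. hessian_form f p (coord v) \<ge> 0)"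
  proof (rule convex_on_iff_second_derivatives_nonneg[OF C])
    fix p v assume p: "p \<in> C"
    show "\<forall>\<^sub>F t in nhds (0::real). p + t *\<^sub>R v \<in> C"
      unfolding line[of p _ v]
      by (intro eventually_convex_combination_line inside p C) auto
    show "((\<lambda>t. f (p + t *\<^sub>R v)) has_real_derivative (\<Sum>r\<in>UNIV. coord v r * D r p)) (at 0)"
      unfolding line[of p _ v]
      by (intro has_derivative_from_continuous_partials[OF _ C p] inside D1 cont p) auto
    have "((\<lambda>t. D r (p + t *\<^sub>R v)) has_real_derivative
        (\<Sum>c\<in>UNIV. coord v c * real_hessian f p r c)) (at 0)" for r
      unfolding line[of p _ v]
      by (intro has_derivative_from_continuous_partials[OF _ C p] inside D2 cont p) auto
    then have "((\<lambda>t. \<Sum>r\<in>UNIV. coord v r * D r (p + t *\<^sub>R v)) has_real_derivative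
        (\<Sum>r\<in>UNIV. coord v r * (\<Sum>c\<in>UNIV. coord v c * real_hessian f p r c))) (at 0)"
      by (intro DERIV_sum DERIV_cmult)
    then show "((\<lambda>t. \<Sum>r\<in>UNIV. coord v r * D r (p + t *\<^sub>R v)) has_real_derivative
        hessian_form f p (coord v)) (at 0)"
      by (simp add: hessian_form_def sum_distrib_left mult.assoc)
  qed
  moreover have "\<exists>v. coord v = d" for d
    using real_coordinates_surj[of d] by (metis coord_def ext)
  ultimately show ?thesis
    by metis
qed

section \<open>The augmented Hessian in terms of the real Hessian\<close>

text \<open>
  The rotated units $u^\mu$: the coefficients of the real components in the augmented vector with
  blocks $q^\mu$, and up to sign those in the GHR derivatives.
\<close>

definition aug_jacobian :: "qunit \<Rightarrow> qunit \<Rightarrow> quat"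
  where "aug_jacobian \<mu> u = quat_rot (qunit_val u) (qunit_val \<mu>)"

lemma inverse_qunit_val: "inverse (qunit_val \<mu>) = quat_cnj (qunit_val \<mu>)"
  by (cases \<mu>) (simp_all add: inverse_quat_def quat_cnj_def qunit_defs)

lemma aug_jacobian_eq: "aug_jacobian \<mu> u = qunit_val \<mu> * qunit_val u * quat_cnj (qunit_val \<mu>)"
  by (simp add: aug_jacobian_def quat_rot_def inverse_qunit_val)

text \<open>
  This is $J^{\mathsf H} J = 4I$. The summands are the rotations of \<open>w = v\<^sup>* u\<close> by the four units, and
  the sum of these rotations is four times the real part of \<open>w\<close>, because each imaginary unit is
  fixed by two of them and negated by the other two.
\<close>

lemma aug_jacobian_orthogonal:
  "(\<Sum>\<nu>\<in>UNIV. quat_cnj (aug_jacobian \<nu> v) * aug_jacobian \<nu> u) = (if u = v then 4 *\<^sub>R 1 else 0)"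
  by (cases u; cases v) (simp_all add: sum_UNIV_qunit aug_jacobian_eq quat_cnj_def qunit_defs quat_ring_defs scaleR_quat_def)

lemma aug_jacobian_U1 [simp]: "aug_jacobian \<mu> U1 = 1"
  by (cases \<mu>) (simp_all add: aug_jacobian_eq quat_cnj_def qunit_defs quat_ring_defs)

lemma quat_cnj_aug_jacobian:
  "quat_cnj (aug_jacobian \<mu> u) = (if u = U1 then 1 else - aug_jacobian \<mu> u)"
  by (cases \<mu>; cases u) (simp_all add: aug_jacobian_eq quat_cnj_def qunit_defs quat_ring_defs)

lemma ghr_conj_deriv_eq_sum:
  "ghr_conj_deriv (qunit_val \<mu>) m g p = (1/4) *\<^sub>R (\<Sum>u\<in>UNIV. partial m u g p * aug_jacobian \<mu> u)"
  by (simp add: ghr_conj_deriv_def sum_UNIV_qunit) (simp add: aug_jacobian_def)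

lemma ghr_deriv_eq_sum:
  "ghr_deriv (qunit_val \<nu>) l g p =
    (1/4) *\<^sub>R (\<Sum>v\<in>UNIV. partial l v g p * quat_cnj (aug_jacobian \<nu> v))"
  by (simp add: ghr_deriv_def sum_UNIV_qunit quat_cnj_aug_jacobian) (simp add: aug_jacobian_def)

text \<open>
  The entrywise form of $\frac{1}{16} J H J^{\mathsf H}$. The inner GHR derivative puts its rotated
  unit to the left of the one from the outer derivative; this is what makes \<open>J\<close> appear on the left
  and its adjoint on the right. The formula for the inner derivative holds on \<open>C\<close> only, which is
  enough because the coordinate lines through \<open>q\<close> stay in \<open>C\<close> near \<open>q\<close>.
\<close>

lemma augmented_hessian_entry:
  fixes C :: "(quat ^ 'n::finite) set" and f :: "quat ^ 'n \<Rightarrow> real"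
  assumes f: "twice_cont_real_differentiable_on C f" and q: "q \<in> C"
  shows "augmented_hessian f q $ (\<mu>, m) $ (\<nu>, l) =
    (1/16) *\<^sub>R (\<Sum>u\<in>UNIV. \<Sum>v\<in>UNIV. real_hessian f q (u, m) (v, l) *\<^sub>R
      (aug_jacobian \<mu> u * quat_cnj (aug_jacobian \<nu> v)))"
proof -
  define g where "g = ghr_conj_deriv (qunit_val \<mu>) m (\<lambda>p. of_real (f p))"
  have f1: "has_partial_on C m u f" and f2: "has_partial_on C l v (partial m u f)" for m u l v
    using f by (auto simp: twice_cont_real_differentiable_on_def)
  have g: "g p = (1/4) *\<^sub>R (\<Sum>u\<in>UNIV. partial m u f p *\<^sub>R aug_jacobian \<mu> u)" if "p \<in> C" for p
  proof -
    have "partial m u (\<lambda>p. of_real (f p) :: quat) p = of_real (partial m u f p)" for u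
    proof -
      have "((\<lambda>t. f (p + t *\<^sub>R real_axis (u, m))) has_vector_derivative partial m u f p) (at 0)"
        by (rule has_partial_onD(2)[OF f1 that])
      then have "((\<lambda>t. f (p + t *\<^sub>R real_axis (u, m)) *\<^sub>R (1::quat)) has_vector_derivative
          partial m u f p *\<^sub>R 1) (at 0)"
        by (rule bounded_linear.has_vector_derivative[OF bounded_linear_scaleR_left])
      then show ?thesis
        by (auto simp: partial_def coord_line_def real_axis_def of_real_def intro: vector_derivative_at)
    qed
    then show ?thesis
      by (simp add: g_def ghr_conj_deriv_eq_sum of_real_def)
  qed
  have "partial l v g q = (1/4) *\<^sub>R (\<Sum>u\<in>UNIV. real_hessian f q (u, m) (v, l) *\<^sub>R aug_jacobian \<mu> u)"
    for v
  proof -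
    have "((\<lambda>t. partial m u f (q + t *\<^sub>R real_axis (v, l))) has_vector_derivative
        real_hessian f q (u, m) (v, l)) (at 0)" for u
      using has_partial_onD(2)[OF f2 q] by (simp add: real_hessian_def eta_contract_eq)
    then have "((\<lambda>t. (1/4) *\<^sub>R (\<Sum>u\<in>UNIV. partial m u f (q + t *\<^sub>R real_axis (v, l)) *\<^sub>R aug_jacobian \<mu> u))
        has_vector_derivative
        (1/4) *\<^sub>R (\<Sum>u\<in>UNIV. real_hessian f q (u, m) (v, l) *\<^sub>R aug_jacobian \<mu> u)) (at 0)"
      by (intro bounded_linear.has_vector_derivative[OF bounded_linear_scaleR_right]
          has_vector_derivative_sum bounded_linear.has_vector_derivative[OF bounded_linear_scaleR_left])
    moreover have "\<forall>\<^sub>F t in nhds 0. g (q + t *\<^sub>R real_axis (v, l)) =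
        (1/4) *\<^sub>R (\<Sum>u\<in>UNIV. partial m u f (q + t *\<^sub>R real_axis (v, l)) *\<^sub>R aug_jacobian \<mu> u)"
      using has_partial_onD(1)[OF f1 q] by eventually_elim (rule g)
    ultimately have "((\<lambda>t. g (q + t *\<^sub>R real_axis (v, l))) has_vector_derivative
        (1/4) *\<^sub>R (\<Sum>u\<in>UNIV. real_hessian f q (u, m) (v, l) *\<^sub>R aug_jacobian \<mu> u)) (at 0)"
      by (subst has_vector_derivative_cong_ev) (auto simp: g q)
    then show ?thesis
      by (auto simp: partial_def coord_line_def real_axis_def intro: vector_derivative_at)
  qed
  then have "augmented_hessian f q $ (\<mu>, m) $ (\<nu>, l) = (1/4) *\<^sub>R (\<Sum>v\<in>UNIV.
      ((1/4) *\<^sub>R (\<Sum>u\<in>UNIV. real_hessian f q (u, m) (v, l) *\<^sub>R aug_jacobian \<mu> u))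
        * quat_cnj (aug_jacobian \<nu> v))"
    by (simp add: augmented_hessian_def ghr_hessian_def ghr_deriv_eq_sum flip: g_def)
  also have "\<dots> = (1/16) *\<^sub>R (\<Sum>v\<in>UNIV. \<Sum>u\<in>UNIV. real_hessian f q (u, m) (v, l) *\<^sub>R
      (aug_jacobian \<mu> u * quat_cnj (aug_jacobian \<nu> v)))"
    by (simp add: sum_distrib_right scaleR_right.sum)
  finally show ?thesis
    by (subst sum.swap)
qed

lemma qa_sandwich: "qa (quat_cnj a * ((J * quat_cnj K) * b)) = inner (quat_cnj J * a) (quat_cnj K * b)"
  by (simp add: times_quat_def quat_cnj_def inner_quat_def algebra_simps)

lemma sum_qunit_blocks_swap:
  "(\<Sum>\<mu>\<in>UNIV. \<Sum>m\<in>UNIV. \<Sum>\<nu>\<in>UNIV. \<Sum>l\<in>UNIV. \<Sum>u\<in>UNIV. \<Sum>v\<in>UNIV. T \<mu> m \<nu> l u v) =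
   (\<Sum>u\<in>UNIV. \<Sum>m\<in>UNIV. \<Sum>v\<in>UNIV. \<Sum>l\<in>UNIV. \<Sum>\<nu>\<in>UNIV. \<Sum>\<mu>\<in>UNIV. T \<mu> m \<nu> l u v)"
  for T :: "qunit \<Rightarrow> 'n::finite \<Rightarrow> qunit \<Rightarrow> 'n \<Rightarrow> qunit \<Rightarrow> qunit \<Rightarrow> real"
  unfolding sum.cartesian_product UNIV_Times_UNIV
  by (rule sum.reindex_bij_witness[where i="\<lambda>(u, m, v, l, \<nu>, \<mu>). (\<mu>, m, \<nu>, l, u, v)"
        and j="\<lambda>(\<mu>, m, \<nu>, l, u, v). (u, m, v, l, \<nu>, \<mu>)"]) auto

text \<open>
  The vector $J^{\mathsf H} x$. On augmented vectors it is four times the vector of real components.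
\<close>

definition real_coords :: "quat ^ (qunit \<times> 'n::finite) \<Rightarrow> qunit \<times> 'n \<Rightarrow> quat"
  where "real_coords x r = (\<Sum>\<nu>\<in>UNIV. quat_cnj (aug_jacobian \<nu> (fst r)) * x $ (\<nu>, snd r))"

text \<open>
  With \<open>y\<close> for $J^{\mathsf H} x$, the left-hand side is a sixteenth of the sum of all
  \<open>H\<^bsub>rc\<^esub> Re(y\<^sub>r\<^sup>* y\<^sub>c)\<close>, and the real part of \<open>y\<^sub>r\<^sup>* y\<^sub>c\<close> is the Euclidean inner product of the
  four real components.
\<close>

lemma qa_augmented_hessian_form:
  fixes C :: "(quat ^ 'n::finite) set" and f :: "quat ^ 'n \<Rightarrow> real"
  assumes f: "twice_cont_real_differentiable_on C f" and q: "q \<in> C"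
  shows "qa (\<Sum>r\<in>UNIV. quat_cnj (x $ r) * (augmented_hessian f q *v x) $ r) =
    (1/16) * (hessian_form f q (\<lambda>r. qa (real_coords x r)) + hessian_form f q (\<lambda>r. qb (real_coords x r))
      + hessian_form f q (\<lambda>r. qc (real_coords x r)) + hessian_form f q (\<lambda>r. qd (real_coords x r)))"
proof -
  let ?H = "real_hessian f q"
  have "qa (\<Sum>r\<in>UNIV. quat_cnj (x $ r) * (augmented_hessian f q *v x) $ r) =
    (\<Sum>\<mu>\<in>UNIV. \<Sum>m\<in>UNIV. \<Sum>\<nu>\<in>UNIV. \<Sum>l\<in>UNIV. \<Sum>u\<in>UNIV. \<Sum>v\<in>UNIV.
      (1/16) * (?H (u, m) (v, l) *
        inner (quat_cnj (aug_jacobian \<mu> u) * x $ (\<mu>, m)) (quat_cnj (aug_jacobian \<nu> v) * x $ (\<nu>, l))))"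
    by (simp add: matrix_vector_mult_def sum_UNIV_prod augmented_hessian_entry[OF f q] qa_sum
        sum_distrib_left sum_distrib_right scaleR_right.sum qa_sandwich)
  also have "\<dots> = (\<Sum>u\<in>UNIV. \<Sum>m\<in>UNIV. \<Sum>v\<in>UNIV. \<Sum>l\<in>UNIV. \<Sum>\<nu>\<in>UNIV. \<Sum>\<mu>\<in>UNIV.
      (1/16) * (?H (u, m) (v, l) *
        inner (quat_cnj (aug_jacobian \<mu> u) * x $ (\<mu>, m)) (quat_cnj (aug_jacobian \<nu> v) * x $ (\<nu>, l))))"
    by (rule sum_qunit_blocks_swap)
  also have "\<dots> = (1/16) * (\<Sum>r\<in>UNIV. \<Sum>c\<in>UNIV. ?H r c * inner (real_coords x r) (real_coords x c))"
    by (simp add: sum_UNIV_prod real_coords_def inner_sum_left inner_sum_right sum_distrib_left)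
  also have "(\<Sum>r\<in>UNIV. \<Sum>c\<in>UNIV. ?H r c * inner (real_coords x r) (real_coords x c)) =
      hessian_form f q (\<lambda>r. qa (real_coords x r)) + hessian_form f q (\<lambda>r. qb (real_coords x r))
      + hessian_form f q (\<lambda>r. qc (real_coords x r)) + hessian_form f q (\<lambda>r. qd (real_coords x r))"
    by (simp add: hessian_form_def inner_quat_def algebra_simps flip: sum.distrib)
  finally show ?thesis .
qed

text \<open>The witness is $\frac14 J d$, by $J^{\mathsf H} J = 4I$.\<close>

lemma real_coords_surj:
  fixes d :: "qunit \<times> 'n::finite \<Rightarrow> real"
  obtains x :: "quat ^ (qunit \<times> 'n)" where "\<And>r. real_coords x r = d r *\<^sub>R 1"
proof
  fix r :: "qunit \<times> 'n"
  let ?x = "\<chi> s. \<Sum>u\<in>UNIV. (d (u, snd s) / 4) *\<^sub>R aug_jacobian (fst s) u"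
  have "real_coords ?x r = (\<Sum>\<nu>\<in>UNIV. \<Sum>u\<in>UNIV. (d (u, snd r) / 4) *\<^sub>R
      (quat_cnj (aug_jacobian \<nu> (fst r)) * aug_jacobian \<nu> u))"
    by (simp add: real_coords_def sum_distrib_left)
  also have "\<dots> = (\<Sum>u\<in>UNIV. (d (u, snd r) / 4) *\<^sub>R
      (\<Sum>\<nu>\<in>UNIV. quat_cnj (aug_jacobian \<nu> (fst r)) * aug_jacobian \<nu> u))"
    by (subst sum.swap) (simp add: scaleR_right.sum)
  also have "\<dots> = (\<Sum>u\<in>UNIV. if u = fst r then d r *\<^sub>R 1 else 0)"
    by (intro sum.cong) (auto simp: aug_jacobian_orthogonal)
  finally show "real_coords ?x r = d r *\<^sub>R 1"
    by simp
qed

lemma quat_psd_augmented_hessian_iff: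
  fixes C :: "(quat ^ 'n::finite) set" and f :: "quat ^ 'n \<Rightarrow> real"
  assumes f: "twice_cont_real_differentiable_on C f" and q: "q \<in> C"
  shows "quat_psd (augmented_hessian f q) \<longleftrightarrow> (\<forall>d. hessian_form f q d \<ge> 0)"
proof
  assume psd: "quat_psd (augmented_hessian f q)"
  show "\<forall>d. hessian_form f q d \<ge> 0"
  proof
    fix d
    obtain x :: "quat ^ (qunit \<times> 'n)" where x: "\<And>r. real_coords x r = d r *\<^sub>R 1"
      using real_coords_surj by blast
    have "0 \<le> qa (\<Sum>r\<in>UNIV. quat_cnj (x $ r) * (augmented_hessian f q *v x) $ r)"
      using psd by (cases "x = 0") (auto simp: quat_psd_def)
    then show "hessian_form f q d \<ge> 0"
      by (simp add: qa_augmented_hessian_form[OF f q] x) (simp add: one_quat_def hessian_form_def)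
  qed
qed (simp add: quat_psd_def qa_augmented_hessian_form[OF f q])

theorem mainTheorem2:
  fixes C :: "(quat ^ 'n::finite) set" and f :: "quat ^ 'n \<Rightarrow> real"
  assumes "convex C"
    and "twice_cont_real_differentiable_on C f"
  shows "convex_on C f \<longleftrightarrow> (\<forall>q\<in>C. quat_psd (augmented_hessian f q))"
  using convex_on_iff_hessian_form_nonneg[OF assms] quat_psd_augmented_hessian_iff[OF assms(2)]
  by blast

end
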